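(* Let $\{C_i\}_{i\in\mathbb{N}}$ be a sequence of convex bodies in $\mathbb{R}^{n+1}$ converging to a convex body $C\subset\mathbb{R}^{n+1}$ in Lipschitz distance. Then $\{C_i\}_{i\in\mathbb{N}}$ converges to $C$ in weak Hausdorff distance, i.e. $\lim_{i\to\infty}\delta_S(C_i,C)=0$.
   Context: A convex body in $\mathbb{R}^{n+1}$ is a compact convex set with non-empty interior. For a convex body $C$ and $r>0$ let $C_r=\{p\in\mathbb{R}^{n+1}: d(p,C)\le r\}$, $d$ being the Euclidean distance. The Hausdorff distance is $\delta(C,C')=\inf\{r>0: C\subset (C')_r,\ C'\subset C_r\}$, and the weak Hausdorff distance is $$\delta_S(C,C')=\inf\{\delta(C,h(C')): h\in\mathrm{Isom}(\mathbb{R}^{n+1})\}.$$ For a Lipschitz map $f$ between metric spaces, $\mathrm{Lip}(f)$ denotes its smallest Lipschitz constant. A bilipschitz map from $C$ to $C'$ is a bijection $f:C\to C'$ such that $f$ and $f^{-1}$ are Lipschitz. The Lipschitz distance is $$d_L(C,C')=\inf_f\,\log\big(\max\{\mathrm{Lip}(f),\mathrm{Lip}(f^{-1})\}\big),$$ the infimum being over all bilipschitz maps $f$ from $C$ to $C'$ (with respect to the Euclidean distance). Convergence of $C_i$ to $C$ in Lipschitz distance means $d_L(C_i,C)\to 0$. *)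

theory Defs
  imports "HOL-Analysis.Analysis"
begin

definition convex_body :: "'a::euclidean_space set \<Rightarrow> bool" where
  "convex_body C \<longleftrightarrow> compact C \<and> convex C \<and> interior C \<noteq> {}"

definition closed_nbhd :: "'a::euclidean_space set \<Rightarrow> real \<Rightarrow> 'a set" where
  "closed_nbhd C r = {p. infdist p C \<le> r}"

definition hausdorff_distance :: "'a::euclidean_space set \<Rightarrow> 'a set \<Rightarrow> real" where
  "hausdorff_distance C C' = Inf {r. r > 0 \<and> C \<subseteq> closed_nbhd C' r \<and> C' \<subseteq> closed_nbhd C r}"

definition Isom :: "('a::euclidean_space \<Rightarrow> 'a) set" where
  "Isom = {h. bij h \<and> (\<forall>x y. dist (h x) (h y) = dist x y)}"

definition weak_hausdorff_distance :: "'a::euclidean_space set \<Rightarrow> 'a set \<Rightarrow> real" where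
  "weak_hausdorff_distance C C' = (INF h\<in>Isom. hausdorff_distance C (h ` C'))"

(* The infimum is attained when f is Lipschitz on U, so this is the smallest Lipschitz constant. *)
definition Lip :: "'a::metric_space set \<Rightarrow> ('a \<Rightarrow> 'b::metric_space) \<Rightarrow> real" where
  "Lip U f = Inf {L. L-lipschitz_on U f}"

(* Maps between subsets are total functions; only the values on C matter,
   and the inverse map from C' to C is inv_into C f. *)
definition bilipschitz_map :: "'a::metric_space set \<Rightarrow> 'b::metric_space set \<Rightarrow> ('a \<Rightarrow> 'b) \<Rightarrow> bool" where
  "bilipschitz_map C C' f \<longleftrightarrow>
     bij_betw f C C' \<and> (\<exists>L. L-lipschitz_on C f) \<and> (\<exists>L. L-lipschitz_on C' (inv_into C f))"

(* Extended-real valued, so that the infimum over an empty family of maps is infinity. *)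
definition lipschitz_distance :: "'a::metric_space set \<Rightarrow> 'b::metric_space set \<Rightarrow> ereal" where
  "lipschitz_distance C C' =
     (INF f\<in>{f. bilipschitz_map C C' f}. ereal (ln (max (Lip C f) (Lip C' (inv_into C f)))))"

end

theory Submission
  imports Defs "HOL-Complex_Analysis.Great_Picard"
begin

text \<open>
  The theorem is a compactness argument. If \<open>C\<^sub>i\<close> is close to \<open>C\<close> in Lipschitz distance, then \<open>C\<^sub>i\<close>
  is the image of \<open>C\<close> under a map \<open>g\<close> that distorts distances by a factor close to 1. Such an
  almost isometric map is uniformly close on \<open>C\<close> to the restriction of a rigid motion \<open>h\<close>
  (lemma \<open>almost_isometry_near_rigid_motion\<close>), and then \<open>C\<^sub>i = g ` C\<close> is Hausdorff close to \<open>h ` C\<close>.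

  The closeness to a rigid motion is proved by contradiction: a sequence of maps with distortion
  tending to 1 that all stay away from rigid motions can be translated so as to fix the image of
  one point, and then Arzela-Ascoli produces a subsequence converging uniformly to an isometric
  embedding of \<open>C\<close>. A set with interior points affinely spans the space, so this embedding is the
  restriction of a rigid motion (lemma \<open>isometric_embedding_extends\<close>), which contradicts the choice
  of the sequence.
\<close>

section \<open>Extending isometric embeddings to rigid motions\<close>

text \<open>
  Extend \<open>g\<close> linearly from a basis inside \<open>S\<close>. The extension \<open>T\<close> preserves inner products because it
  does so on the basis. On the rest of \<open>S\<close> it agrees with \<open>g\<close>, because \<open>g x\<close> and \<open>T x\<close> have the
  same inner products with all vectors in the range of \<open>T\<close>, which is everything.
\<close>
lemma inner_preserving_extends:
  fixes g :: "'a::euclidean_space \<Rightarrow> 'a"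
  assumes span: "span S = UNIV"
    and inner: "\<And>x y. x \<in> S \<Longrightarrow> y \<in> S \<Longrightarrow> g x \<bullet> g y = x \<bullet> y"
  obtains T where "orthogonal_transformation T" "\<And>x. x \<in> S \<Longrightarrow> T x = g x"
proof -
  obtain B where B: "B \<subseteq> S" "independent B" "S \<subseteq> span B"
    using maximal_independent_subset by blast
  have spanB: "span B = UNIV"
    using B(3) span span_minimal[OF B(3)] by auto
  obtain T where T: "linear T" "\<And>b. b \<in> B \<Longrightarrow> T b = g b"
    using linear_independent_extend[OF B(2), of g] by blast
  interpret T: linear T by fact
  have "T v \<bullet> T w = v \<bullet> w" for v w
  proof -
    have "bilinear (\<lambda>v w. T v \<bullet> T w)" "bilinear (\<lambda>v w::'a. v \<bullet> w)"
      by (auto simp: bilinear_def T.add T.scaleR inner_add intro!: linearI)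
    moreover have "T x \<bullet> T y = x \<bullet> y" if "x \<in> B" "y \<in> B" for x y
      using that B T inner by (metis subsetD)
    ultimately show ?thesis
      using bilinear_eq[of "\<lambda>v w. T v \<bullet> T w" "\<lambda>v w. v \<bullet> w" UNIV B UNIV B v w] by (simp add: spanB)
  qed
  then have orth: "orthogonal_transformation T"
    using T by (simp add: orthogonal_transformation_def)
  have "T x = g x" if x: "x \<in> S" for x
  proof -
    have "T v \<bullet> g x = v \<bullet> x" for v
    proof -
      have "linear (\<lambda>v. T v \<bullet> g x)" "linear (\<lambda>v. v \<bullet> x)"
        by (auto simp: T.add T.scaleR inner_add intro!: linearI)
      moreover have "T b \<bullet> g x = b \<bullet> x" if "b \<in> B" for b
        using that B T inner x by (metis subsetD)
      ultimately show ?thesis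
        using linear_eq_on[of "\<lambda>v. T v \<bullet> g x" "\<lambda>v. v \<bullet> x" v B] by (simp add: spanB)
    qed
    then have "T v \<bullet> (g x - T x) = 0" for v
      using orth by (simp add: inner_diff_right orthogonal_transformation_def)
    moreover obtain v where "T v = g x - T x"
      using orthogonal_transformation_surj[OF orth] by (metis surjD)
    ultimately show ?thesis
      by (metis inner_eq_zero_iff right_minus_eq)
  qed
  with orth show thesis
    using that by blast
qed

text \<open>
  Moving a point of \<open>S\<close> and its image to the origin reduces this to the linear case: a map that
  fixes the origin and preserves distances preserves norms, hence by polarization inner products.
\<close>
lemma isometric_embedding_extends:
  fixes g :: "'a::euclidean_space \<Rightarrow> 'a"
  assumes hull: "affine hull S = UNIV"
    and dist: "\<And>x y. x \<in> S \<Longrightarrow> y \<in> S \<Longrightarrow> dist (g x) (g y) = dist x y"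
  obtains h where "h \<in> Isom" "\<And>x. x \<in> S \<Longrightarrow> h x = g x"
proof -
  obtain a where a: "a \<in> S"
    using hull by fastforce
  define S' where "S' = (\<lambda>x. - a + x) ` (S - {a})"
  define G where "G v = g (a + v) - g a" for v
  have "(\<lambda>x. a + x) ` span S' = UNIV"
    using affine_hull_span2[OF a] hull by (simp add: S'_def)
  then have "v \<in> span S'" for v
    using UNIV_I[of "a + v"] by (metis (no_types, lifting) add_left_imp_eq imageE)
  then have "span S' = UNIV"
    by auto
  moreover have "G v \<bullet> G w = v \<bullet> w" if "v \<in> S'" "w \<in> S'" for v w
  proof -
    have S: "a + v \<in> S" "a + w \<in> S"
      using that by (auto simp: S'_def)
    have "norm (G v) = norm v" "norm (G w) = norm w" "norm (G v - G w) = norm (v - w)"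
      using dist[OF S(1) a] dist[OF S(2) a] dist[OF S] by (simp_all add: G_def dist_norm)
    then show ?thesis
      by (simp add: dot_norm_neg)
  qed
  ultimately obtain T where T: "orthogonal_transformation T" "\<And>v. v \<in> S' \<Longrightarrow> T v = G v"
    using inner_preserving_extends by blast
  have lin: "linear T"
    using T(1) orthogonal_transformation_linear by blast
  define h where "h x = g a + T (x - a)" for x
  have "bij h"
  proof -
    have "bij ((\<lambda>x. g a + x) \<circ> T \<circ> (\<lambda>x. x - a))"
      using orthogonal_transformation_bij[OF T(1)] by (intro bij_comp) (simp_all add: bij_diff_right)
    then show ?thesis
      by (simp add: h_def[abs_def] o_def)
  qed
  moreover have "dist (h x) (h y) = dist x y" for x y
    using orthogonal_transformation_norm[OF T(1), of "(x - a) - (y - a)"]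
    by (simp add: h_def dist_norm linear_diff[OF lin, symmetric])
  moreover have "h x = g x" if "x \<in> S" for x
  proof (cases "x = a")
    case True
    then show ?thesis
      by (simp add: h_def linear_0[OF lin])
  next
    case False
    then have "x - a \<in> S'"
      using that by (force simp: S'_def)
    then show ?thesis
      by (simp add: h_def T G_def)
  qed
  ultimately show thesis
    using that[of h] by (simp add: Isom_def)
qed

lemma translated_Isom:
  assumes "h \<in> Isom"
  shows "(\<lambda>x. h x + c) \<in> Isom"
proof -
  have "bij ((\<lambda>x. x + c) \<circ> h)"
    using assms by (intro bij_comp) (auto simp: Isom_def bij_plus_right)
  then show ?thesis
    using assms by (simp add: Isom_def o_def)
qed

section \<open>Almost isometric maps are close to rigid motions\<close>

text \<open>The limit step of the compactness argument: Arzela-Ascoli applied to maps that have been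
  normalised by a translation to vanish at a common point.\<close>
lemma asymptotic_isometries_converge:
  fixes g :: "nat \<Rightarrow> 'a::euclidean_space \<Rightarrow> 'a"
  assumes C: "compact C" "affine hull C = UNIV" and a: "a \<in> C"
    and L: "L \<longlonglongrightarrow> 1" "\<And>n. L n \<le> K"
    and upper: "\<And>n x y. x \<in> C \<Longrightarrow> y \<in> C \<Longrightarrow> dist (g n x) (g n y) \<le> L n * dist x y"
    and lower: "\<And>n x y. x \<in> C \<Longrightarrow> y \<in> C \<Longrightarrow> dist x y \<le> L n * dist (g n x) (g n y)"
    and e: "e > 0"
    and ga: "\<And>n. g n a = 0"
  obtains n h where "h \<in> Isom" "\<And>x. x \<in> C \<Longrightarrow> dist (g n x) (h x) \<le> e"
proof -
  obtain R where R: "\<And>x. x \<in> C \<Longrightarrow> dist x a \<le> R"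
    using compact_imp_bounded[OF C(1)] bounded_any_center[of C a] by (auto simp: dist_commute)
  have lip: "dist (g n x) (g n y) \<le> max K 1 * dist x y" if "x \<in> C" "y \<in> C" for n x y
  proof -
    have "L n * dist x y \<le> max K 1 * dist x y"
      using L(2)[of n] by (intro mult_right_mono) auto
    then show ?thesis
      using upper[OF that, of n] by linarith
  qed
  have bdd: "norm (g n x) \<le> max K 1 * R" if "x \<in> C" for n x
  proof -
    have "max K 1 * dist x a \<le> max K 1 * R"
      using R[OF that] by (intro mult_left_mono) auto
    then show ?thesis
      using lip[OF that a, of n] ga by simp
  qed
  have equi: "\<exists>d. 0 < d \<and> (\<forall>n y. y \<in> C \<and> norm (x - y) < d \<longrightarrow> norm (g n x - g n y) < \<epsilon>)"
    if "x \<in> C" "0 < \<epsilon>" for x \<epsilon>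
  proof (intro exI conjI allI impI)
    show "0 < \<epsilon> / max K 1"
      using that by auto
    fix n y assume y: "y \<in> C \<and> norm (x - y) < \<epsilon> / max K 1"
    then have "max K 1 * dist x y < \<epsilon>"
      by (simp add: dist_norm pos_less_divide_eq mult.commute)
    then show "norm (g n x - g n y) < \<epsilon>"
      using lip[of x y n] that y by (simp add: dist_norm)
  qed
  obtain f and k :: "nat \<Rightarrow> nat" where k: "strict_mono k"
    and f: "\<And>\<epsilon>. 0 < \<epsilon> \<Longrightarrow> \<exists>N. \<forall>n x. n \<ge> N \<and> x \<in> C \<longrightarrow> norm (g (k n) x - f x) < \<epsilon>"
  proof (rule Arzela_Ascoli[OF C(1), of g "max K 1 * R"])
    fix f k
    assume "strict_mono (k :: nat \<Rightarrow> nat)"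
      and "\<And>\<epsilon>. 0 < \<epsilon> \<Longrightarrow> \<exists>N. \<forall>n x. n \<ge> N \<and> x \<in> C \<longrightarrow> norm (g (k n) x - f x) < \<epsilon>"
    then show thesis
      by (rule that)
  qed (erule bdd, erule (1) equi)
  have lim: "(\<lambda>n. g (k n) x) \<longlonglongrightarrow> f x" if "x \<in> C" for x
    using f that by (fastforce simp: LIMSEQ_iff)
  have Lk: "(\<lambda>n. L (k n)) \<longlonglongrightarrow> 1"
    using LIMSEQ_subseq_LIMSEQ[OF L(1) k] by (simp add: o_def)
  have "dist (f x) (f y) = dist x y" if "x \<in> C" "y \<in> C" for x y
  proof (rule antisym)
    have d: "(\<lambda>n. dist (g (k n) x) (g (k n) y)) \<longlonglongrightarrow> dist (f x) (f y)"
      using that by (intro tendsto_dist lim)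
    have "(\<lambda>n. L (k n) * dist x y) \<longlonglongrightarrow> 1 * dist x y"
      by (intro tendsto_intros Lk)
    then show "dist (f x) (f y) \<le> dist x y"
      using LIMSEQ_le[OF d] upper[OF that] by auto
    have "(\<lambda>n. L (k n) * dist (g (k n) x) (g (k n) y)) \<longlonglongrightarrow> 1 * dist (f x) (f y)"
      by (intro tendsto_intros Lk d)
    then show "dist x y \<le> dist (f x) (f y)"
      using LIMSEQ_le_const[of _ "dist (f x) (f y)"] lower[OF that] by auto
  qed
  then obtain h where h: "h \<in> Isom" "\<And>x. x \<in> C \<Longrightarrow> h x = f x"
    using isometric_embedding_extends[OF C(2)] by blast
  obtain N where "\<And>x. x \<in> C \<Longrightarrow> norm (g (k N) x - f x) < e"
    using f[OF e] by blast
  then have "\<And>x. x \<in> C \<Longrightarrow> dist (g (k N) x) (h x) \<le> e"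
    using h by (auto simp: dist_norm less_imp_le)
  then show thesis
    using that h by blast
qed

text \<open>The constant \<open>L\<close> depends on \<open>C\<close> and \<open>e\<close> only. This uniformity is what the theorem needs, as the
  maps from \<open>C\<close> onto the bodies \<open>C\<^sub>i\<close> are unrelated to each other.\<close>
lemma almost_isometry_near_rigid_motion:
  fixes C :: "'a::euclidean_space set"
  assumes C: "compact C" "affine hull C = UNIV" and e: "e > 0"
  obtains L where "L > 1"
    "\<And>g. (\<And>x y. x \<in> C \<Longrightarrow> y \<in> C \<Longrightarrow> dist (g x) (g y) \<le> L * dist x y \<and> dist x y \<le> L * dist (g x) (g y))
       \<Longrightarrow> \<exists>h\<in>Isom. \<forall>x\<in>C. dist (g x) (h x) \<le> e"
proof (rule ccontr)
  note L_near = that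
  define almost_iso :: "real \<Rightarrow> ('a \<Rightarrow> 'a) \<Rightarrow> bool" where
    "almost_iso L g \<longleftrightarrow> (\<forall>x\<in>C. \<forall>y\<in>C. dist (g x) (g y) \<le> L * dist x y \<and> dist x y \<le> L * dist (g x) (g y))"
    for L g
  define near :: "('a \<Rightarrow> 'a) \<Rightarrow> bool" where
    "near g \<longleftrightarrow> (\<exists>h\<in>Isom. \<forall>x\<in>C. dist (g x) (h x) \<le> e)" for g
  assume no_thesis: "\<not> thesis"
  have "\<exists>g. almost_iso L g \<and> \<not> near g" if "L > 1" for L
    using no_thesis \<open>L > 1\<close> L_near unfolding almost_iso_def near_def by blast
  then have "\<exists>g. almost_iso (1 + 1 / real (Suc n)) g \<and> \<not> near g" for n
    by simp
  then obtain g where g: "\<And>n. almost_iso (1 + 1 / real (Suc n)) (g n)" "\<And>n. \<not> near (g n)"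
    by metis
  obtain a where a: "a \<in> C"
    using C(2) by fastforce
  have "(\<lambda>n. 1 + 1 / real (Suc n)) \<longlonglongrightarrow> 1 + 0"
    by (intro tendsto_add tendsto_const LIMSEQ_Suc[OF lim_1_over_n])
  then have lim: "(\<lambda>n. 1 + 1 / real (Suc n)) \<longlonglongrightarrow> 1"
    by simp
  obtain n h where h: "h \<in> Isom" "\<And>x. x \<in> C \<Longrightarrow> dist (g n x - g n a) (h x) \<le> e"
  proof (rule asymptotic_isometries_converge[OF C a lim, of 2 "\<lambda>n x. g n x - g n a" e])
    show "dist (g n x - g n a) (g n y - g n a) \<le> (1 + 1 / real (Suc n)) * dist x y"
         "dist x y \<le> (1 + 1 / real (Suc n)) * dist (g n x - g n a) (g n y - g n a)"
      if "x \<in> C" "y \<in> C" for n x y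
      using g(1)[of n] that by (simp_all add: almost_iso_def dist_norm)
  qed (use e in \<open>auto simp: field_simps\<close>)
  have "dist (g n x) (h x + g n a) \<le> e" if "x \<in> C" for x
    using h(2)[OF that] by (simp add: dist_norm algebra_simps)
  then have "near (g n)"
    unfolding near_def by (intro bexI[OF _ translated_Isom[OF h(1), of "g n a"]] ballI)
  then show False
    using g(2) by simp
qed

section \<open>Lipschitz and Hausdorff distances\<close>

text \<open>A map witnessing a small Lipschitz distance is inverted here, so that all maps later have
  the fixed domain \<open>C\<close>.\<close>
lemma lipschitz_distance_lessE:
  fixes D :: "'a::metric_space set" and C :: "'b::metric_space set"
  assumes less: "lipschitz_distance D C < ereal (ln L)" and L: "L > 0"
  obtains g where "g ` C = D"
    "\<And>x y. x \<in> C \<Longrightarrow> y \<in> C \<Longrightarrow> dist (g x) (g y) \<le> L * dist x y \<and> dist x y \<le> L * dist (g x) (g y)"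
proof -
  have lipschitz: "dist (u x) (u y) \<le> L * dist x y"
    if "\<exists>K. K-lipschitz_on U u" "Lip U u < L" "x \<in> U" "y \<in> U"
    for U :: "'c::metric_space set" and u :: "'c \<Rightarrow> 'd::metric_space" and x y
  proof -
    have "\<exists>K\<in>{K. K-lipschitz_on U u}. K < L"
      using that(1,2) by (intro cInf_lessD) (simp_all add: Lip_def)
    then obtain K where "K-lipschitz_on U u" "K < L"
      by blast
    then show ?thesis
      using that by (meson lipschitz_onD lipschitz_on_mono less_imp_le order_refl)
  qed
  obtain f where f: "bilipschitz_map D C f"
    and ln: "ln (max (Lip D f) (Lip C (inv_into D f))) < ln L"
    using less by (auto simp: lipschitz_distance_def INF_less_iff)
  \<comment> \<open>\<open>ln\<close> is monotone only at positive arguments, but a maximum \<open>\<le> 0\<close> is below \<open>L\<close> anyway.\<close>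
  have "max (Lip D f) (Lip C (inv_into D f)) < L"
  proof (cases "max (Lip D f) (Lip C (inv_into D f)) > 0")
    case True
    then show ?thesis
      using ln L by (metis ln_less_cancel_iff)
  qed (use L in linarith)
  then have Lip: "Lip D f < L" "Lip C (inv_into D f) < L"
    by auto
  have bij: "bij_betw f D C"
    using f by (simp add: bilipschitz_map_def)
  define g where "g = inv_into D f"
  have img: "g ` C = D"
    using bij_betw_inv_into[OF bij] by (simp add: g_def bij_betw_def)
  moreover have "dist (g x) (g y) \<le> L * dist x y \<and> dist x y \<le> L * dist (g x) (g y)"
    if "x \<in> C" "y \<in> C" for x y
  proof
    show "dist (g x) (g y) \<le> L * dist x y"
      using lipschitz[OF _ Lip(2) that] f by (simp add: g_def bilipschitz_map_def)
    have "f (g x) = x" "f (g y) = y"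
      using that bij_betw_inv_into_right[OF bij] by (auto simp: g_def)
    then show "dist x y \<le> L * dist (g x) (g y)"
      using lipschitz[OF _ Lip(1), of "g x" "g y"] f img that
      by (metis bilipschitz_map_def image_eqI)
  qed
  ultimately show thesis
    using that by blast
qed

lemma hausdorff_distance_image_le:
  assumes "e > 0" and "\<And>x. x \<in> C \<Longrightarrow> dist (g x) (h x) \<le> e"
  shows "hausdorff_distance (g ` C) (h ` C) \<le> e"
  unfolding hausdorff_distance_def
proof (rule cInf_lower)
  show "e \<in> {r. r > 0 \<and> g ` C \<subseteq> closed_nbhd (h ` C) r \<and> h ` C \<subseteq> closed_nbhd (g ` C) r}"
    using assms by (auto simp: closed_nbhd_def intro: infdist_le2 simp: dist_commute)
  show "bdd_below {r. r > 0 \<and> g ` C \<subseteq> closed_nbhd (h ` C) r \<and> h ` C \<subseteq> closed_nbhd (g ` C) r}"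
    by (auto intro!: bdd_belowI[of _ 0])
qed

text \<open>The bound needs some admissible radius, since the infimum of the empty set of reals is
  unspecified. Bounded non-empty sets have one: the diameter of their union, made positive.\<close>
lemma hausdorff_distance_nonneg:
  assumes "bounded C" "bounded D" "C \<noteq> {}" "D \<noteq> {}"
  shows "hausdorff_distance C D \<ge> 0"
proof -
  define r where "r = diameter (C \<union> D) + 1"
  have near: "dist x y \<le> r" if "x \<in> C \<union> D" "y \<in> C \<union> D" for x y
    using diameter_bounded_bound[OF _ that] assms by (simp add: r_def)
  have "r > 0"
    using diameter_ge_0[of "C \<union> D"] assms by (simp add: r_def)
  moreover have "C \<subseteq> closed_nbhd D r" "D \<subseteq> closed_nbhd C r"
    using assms(3,4) near by (auto simp: closed_nbhd_def intro: infdist_le2)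
  ultimately show ?thesis
    unfolding hausdorff_distance_def by (intro cInf_greatest) auto
qed

lemma hausdorff_distance_Isom_nonneg:
  assumes "bounded D" "D \<noteq> {}" "compact C" "C \<noteq> {}" "h \<in> Isom"
  shows "hausdorff_distance D (h ` C) \<ge> 0"
proof -
  have "continuous_on C h"
    using assms(5) by (auto simp: Isom_def continuous_on_iff)
  then have "bounded (h ` C)"
    using assms(3) by (intro compact_imp_bounded compact_continuous_image)
  then show ?thesis
    using assms by (intro hausdorff_distance_nonneg) auto
qed

lemma weak_hausdorff_distance_nonneg:
  assumes "bounded D" "D \<noteq> {}" "compact C" "C \<noteq> {}"
  shows "weak_hausdorff_distance D C \<ge> 0"
  unfolding weak_hausdorff_distance_def
proof (rule cINF_greatest)
  show "hausdorff_distance D (h ` C) \<ge> 0" if "h \<in> Isom" for h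
    using hausdorff_distance_Isom_nonneg[OF assms that] .
  have "id \<in> Isom"
    by (simp add: Isom_def)
  then show "Isom \<noteq> {}"
    by blast
qed

lemma weak_hausdorff_distance_le:
  assumes "bounded D" "D \<noteq> {}" "compact C" "C \<noteq> {}" "h \<in> Isom"
  shows "weak_hausdorff_distance D C \<le> hausdorff_distance D (h ` C)"
  unfolding weak_hausdorff_distance_def
proof (rule cINF_lower)
  show "bdd_below ((\<lambda>h. hausdorff_distance D (h ` C)) ` Isom)"
    using hausdorff_distance_Isom_nonneg[OF assms(1-4)] by (rule bdd_belowI2)
qed (fact assms(5))

section \<open>Lipschitz convergence implies weak Hausdorff convergence\<close>

theorem theorem3p8:
  fixes C :: "'a::euclidean_space set" and Ci :: "nat \<Rightarrow> 'a set"
  assumes "\<And>i. convex_body (Ci i)"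
    and "convex_body C"
    and "(\<lambda>i. lipschitz_distance (Ci i) C) \<longlonglongrightarrow> 0"
  shows "(\<lambda>i. weak_hausdorff_distance (Ci i) C) \<longlonglongrightarrow> 0"
proof (rule tendstoI)
  fix e :: real assume "e > 0"
  then have e: "e / 2 > 0"
    by simp
  have C: "compact C" "affine hull C = UNIV" "C \<noteq> {}"
    using assms(2) affine_hull_nonempty_interior[of C] by (auto simp: convex_body_def)
  have Ci: "bounded (Ci i)" "Ci i \<noteq> {}" for i
    using assms(1)[of i] by (auto simp: convex_body_def compact_imp_bounded)
  obtain L where L: "L > 1" and near:
    "\<And>g. (\<And>x y. x \<in> C \<Longrightarrow> y \<in> C \<Longrightarrow> dist (g x) (g y) \<le> L * dist x y \<and> dist x y \<le> L * dist (g x) (g y))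
       \<Longrightarrow> \<exists>h\<in>Isom. \<forall>x\<in>C. dist (g x) (h x) \<le> e / 2"
    using almost_isometry_near_rigid_motion[OF C(1,2) e] by blast
  have "\<forall>\<^sub>F i in sequentially. lipschitz_distance (Ci i) C < ereal (ln L)"
    using L by (intro order_tendstoD(2)[OF assms(3)]) simp
  then show "\<forall>\<^sub>F i in sequentially. dist (weak_hausdorff_distance (Ci i) C) 0 < e"
  proof eventually_elim
    case (elim i)
    obtain g where g: "g ` C = Ci i"
      "\<And>x y. x \<in> C \<Longrightarrow> y \<in> C \<Longrightarrow> dist (g x) (g y) \<le> L * dist x y \<and> dist x y \<le> L * dist (g x) (g y)"
      using lipschitz_distance_lessE[OF elim] L by auto
    obtain h where h: "h \<in> Isom" "\<And>x. x \<in> C \<Longrightarrow> dist (g x) (h x) \<le> e / 2"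
      using near[OF g(2)] by blast
    have "weak_hausdorff_distance (Ci i) C \<le> hausdorff_distance (g ` C) (h ` C)"
      using weak_hausdorff_distance_le[OF Ci C(1,3) h(1)] g(1) by simp
    also have "\<dots> \<le> e / 2"
      using hausdorff_distance_image_le[OF e h(2)] .
    finally show ?case
      using weak_hausdorff_distance_nonneg[OF Ci C(1,3), of i] \<open>e > 0\<close> by simp
  qed
qed

end
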